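(* Let $\mathcal{X}=\{x_i\}_{i=1}^m$ be a frame for $\mathbb{R}^n$ that is piecewise scalable with an orthogonal projection $P$ of rank $k$. Then: (1) For every unitary transformation $U:\mathbb{R}^n\to\mathbb{R}^n$, the frame $U(\mathcal{X})=\{Ux_i\}_{i=1}^m$ is piecewise scalable. (2) For every orthogonal projection $Q:\mathbb{R}^n\to\mathbb{R}^n$ of rank $k$, there exists a unitary transformation $U:\mathbb{R}^n\to\mathbb{R}^n$ such that $U(\mathcal{X})=\{Ux_i\}_{i=1}^m$ is piecewise scalable with the projection $Q$.
   Context: A finite family $\{x_i\}_{i=1}^m$ in $\mathbb{R}^n$ is a frame for $\mathbb{R}^n$ if there are constants $0<A\le B<\infty$ with $A\|x\|^2\le\sum_{i=1}^m|\langle x,x_i\rangle|^2\le B\|x\|^2$ for all $x\in\mathbb{R}^n$; it is a Parseval frame if $\sum_{i=1}^m|\langle x,x_i\rangle|^2=\|x\|^2$ for all $x\in\mathbb{R}^n$. An orthogonal projection is a linear map $P$ with $P\circ P=P$ and $P^*=P$. A frame $\{x_i\}_{i=1}^m$ for $\mathbb{R}^n$ is piecewise scalable with an orthogonal projection $P$ if there exist real constants $\{a_i,b_i\}_{i=1}^m$ such that $\{a_iPx_i+b_i(I-P)x_i\}_{i=1}^m$ is a Parseval frame for $\mathbb{R}^n$; it is piecewise scalable if this holds for some orthogonal projection $P$. A unitary transformation of $\mathbb{R}^n$ is a linear map $U:\mathbb{R}^n\to\mathbb{R}^n$ with $U^*U=UU^*=I$. *)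

theory Defs
  imports "HOL-Analysis.Analysis"
begin

text \<open>A finite family \<open>{x\<^sub>i}\<close>, \<open>1 \<le> i \<le> m\<close>, is encoded by a function on \<open>nat\<close> of which only the
  values on \<open>{1..m}\<close> matter; repeated and zero vectors are allowed.\<close>

definition is_frame :: "nat \<Rightarrow> (nat \<Rightarrow> real ^ 'n) \<Rightarrow> bool" where
  "is_frame m x \<longleftrightarrow>
    (\<exists>A B::real. 0 < A \<and> A \<le> B \<and>
      (\<forall>v. A * (norm v)\<^sup>2 \<le> (\<Sum>i=1..m. \<bar>v \<bullet> x i\<bar>\<^sup>2) \<and>
           (\<Sum>i=1..m. \<bar>v \<bullet> x i\<bar>\<^sup>2) \<le> B * (norm v)\<^sup>2))"

definition parseval_frame :: "nat \<Rightarrow> (nat \<Rightarrow> real ^ 'n) \<Rightarrow> bool" where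
  "parseval_frame m x \<longleftrightarrow> (\<forall>v. (\<Sum>i=1..m. \<bar>v \<bullet> x i\<bar>\<^sup>2) = (norm v)\<^sup>2)"

text \<open>The library's \<^const>\<open>adjoint\<close> is only meaningful for linear maps, hence the explicit linearity
  conjuncts below.\<close>

definition orthogonal_projection :: "(real ^ 'n \<Rightarrow> real ^ 'n) \<Rightarrow> bool" where
  "orthogonal_projection P \<longleftrightarrow> linear P \<and> P \<circ> P = P \<and> adjoint P = P"

definition unitary_transformation :: "(real ^ 'n \<Rightarrow> real ^ 'n) \<Rightarrow> bool" where
  "unitary_transformation U \<longleftrightarrow> linear U \<and> adjoint U \<circ> U = id \<and> U \<circ> adjoint U = id"

text \<open>Piecewise scalability is a property of frames relative to an orthogonal projection; both
  presuppositions are part of the predicate, so that asserting it also asserts them.\<close>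

definition piecewise_scalable_with ::
  "nat \<Rightarrow> (nat \<Rightarrow> real ^ 'n) \<Rightarrow> (real ^ 'n \<Rightarrow> real ^ 'n) \<Rightarrow> bool" where
  "piecewise_scalable_with m x P \<longleftrightarrow>
    is_frame m x \<and> orthogonal_projection P \<and>
    (\<exists>a b :: nat \<Rightarrow> real. parseval_frame m (\<lambda>i. a i *\<^sub>R P (x i) + b i *\<^sub>R (x i - P (x i))))"

definition piecewise_scalable :: "nat \<Rightarrow> (nat \<Rightarrow> real ^ 'n) \<Rightarrow> bool" where
  "piecewise_scalable m x \<longleftrightarrow> (\<exists>P. piecewise_scalable_with m x P)"

end

theory Submission
  imports Defs
begin

text \<open>If \<open>U\<close> is unitary, the constants witnessing piecewise scalability of \<open>x\<close> with \<open>P\<close> also witness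
  it for \<open>U x\<close> with \<open>U P U\<^sup>*\<close>, because \<open>U\<close> carries the one Parseval frame to the other. For (2),
  gluing isometries \<open>range P \<rightarrow> range Q\<close> and \<open>ker P \<rightarrow> ker Q\<close>, which exist by equality of
  dimensions, gives a unitary \<open>U\<close> with \<open>U P U\<^sup>* = Q\<close>.\<close>

lemma orthogonal_projectionD:
  assumes "orthogonal_projection P"
  shows "linear P" "P (P v) = P v" "P v \<bullet> w = v \<bullet> P w"
  using assms adjoint_works[of P v w]
  by (auto simp: orthogonal_projection_def fun_eq_iff inner_commute)

lemma orthogonal_projectionI:
  assumes "linear P" "\<And>v. P (P v) = P v" "\<And>v w. P v \<bullet> w = v \<bullet> P w"
  shows "orthogonal_projection P"
  unfolding orthogonal_projection_def
  using assms adjoint_unique[of P P] by (auto simp: fun_eq_iff)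

lemma unitary_transformationD:
  assumes "unitary_transformation U"
  shows "linear U" "adjoint U (U v) = v" "U (adjoint U v) = v"
    "norm (adjoint U v) = norm v" "v \<bullet> U w = adjoint U v \<bullet> w"
proof -
  show lin: "linear U" and "adjoint U (U v) = v" and inv: "U (adjoint U v) = v" for v
    using assms by (auto simp: unitary_transformation_def fun_eq_iff)
  show adj: "v \<bullet> U w = adjoint U v \<bullet> w" for v w
    using adjoint_works[OF lin, of w v] by (simp add: inner_commute)
  show "norm (adjoint U v) = norm v"
    using adj[of v "adjoint U v"] by (simp add: norm_eq_sqrt_inner inv)
qed

text \<open>By polarization, preserving norms forces preserving inner products, which makes
  \<open>adjoint U\<close> a left inverse of \<open>U\<close>. In finite dimension a left inverse of
  a linear endomorphism is also a right inverse.\<close>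

lemma unitary_transformationI:
  fixes U :: "real ^ 'n \<Rightarrow> real ^ 'n"
  assumes "linear U" "\<And>v. norm (U v) = norm v"
  shows "unitary_transformation U"
proof -
  have ot: "orthogonal_transformation U"
    using assms by (simp add: orthogonal_transformation)
  have "w \<bullet> adjoint U (U v) = w \<bullet> v" for v w
    using ot adjoint_works[OF assms(1), of w "U v"] by (simp add: orthogonal_transformation_def)
  then have "adjoint U \<circ> U = id"
    by (auto simp: fun_eq_iff intro: vector_eq_ldot[THEN iffD1])
  then show ?thesis
    using assms(1) adjoint_linear linear_inverse_left
    unfolding unitary_transformation_def by blast
qed

text \<open>Moving \<open>U\<close> across the inner product turns the sum for \<open>U x\<close> at
  \<open>v\<close> into the sum for \<open>x\<close> at \<open>adjoint U v\<close>, a vector of the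
  same norm, so the same bounds serve.\<close>

lemma is_frame_unitary:
  assumes U: "unitary_transformation U" and "is_frame m x"
  shows "is_frame m (\<lambda>i. U (x i))"
  using assms(2) unfolding is_frame_def by (simp add: unitary_transformationD(5)[OF U])
    (metis unitary_transformationD(4)[OF U])

lemma parseval_frame_unitary:
  assumes U: "unitary_transformation U" and "parseval_frame m x"
  shows "parseval_frame m (\<lambda>i. U (x i))"
  using assms(2) unitary_transformationD(4,5)[OF U] unfolding parseval_frame_def by simp

lemma piecewise_scalable_with_unitary:
  assumes U: "unitary_transformation U" and "piecewise_scalable_with m x P"
  shows "piecewise_scalable_with m (\<lambda>i. U (x i)) (U \<circ> P \<circ> adjoint U)"
proof -
  note Ud = unitary_transformationD[OF U]
  obtain a b where fr: "is_frame m x" and P: "orthogonal_projection P"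
    and ab: "parseval_frame m (\<lambda>i. a i *\<^sub>R P (x i) + b i *\<^sub>R (x i - P (x i)))"
    using assms(2) unfolding piecewise_scalable_with_def by blast
  note Pd = orthogonal_projectionD[OF P]
  have "orthogonal_projection (U \<circ> P \<circ> adjoint U)"
  proof (rule orthogonal_projectionI)
    show "linear (U \<circ> P \<circ> adjoint U)"
      by (intro linear_compose adjoint_linear Ud Pd)
    show "(U \<circ> P \<circ> adjoint U) v \<bullet> w = v \<bullet> (U \<circ> P \<circ> adjoint U) w" for v w
    proof -
      have "U (P (adjoint U v)) \<bullet> w = P (adjoint U v) \<bullet> adjoint U w"
        using Ud(5)[of w "P (adjoint U v)"] by (simp only: inner_commute)
      also have "\<dots> = v \<bullet> U (P (adjoint U w))"
        by (simp only: Pd(3) Ud(5))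
      finally show ?thesis by simp
    qed
  qed (simp add: Ud(2) Pd(2))
  \<comment> \<open>At \<open>U (x i)\<close> the inner \<open>adjoint U\<close> cancels, so the
    conjugated projection returns \<open>U (P (x i))\<close>; the coefficients stay
    unchanged.\<close>
  moreover have "U (a i *\<^sub>R P (x i) + b i *\<^sub>R (x i - P (x i))) =
    a i *\<^sub>R (U \<circ> P \<circ> adjoint U) (U (x i)) + b i *\<^sub>R (U (x i) - (U \<circ> P \<circ> adjoint U) (U (x i)))" for i
    by (simp add: Ud(2) linear_add[OF Ud(1)] linear_diff[OF Ud(1)] linear_scale[OF Ud(1)])
  ultimately show ?thesis
    unfolding piecewise_scalable_with_def
    using is_frame_unitary[OF U fr] parseval_frame_unitary[OF U ab] by auto
qed

text \<open>Pythagoras: \<open>P v\<close> and \<open>v - P v\<close> are orthogonal.\<close>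

lemma norm_orthogonal_projection_decomp:
  assumes "orthogonal_projection P"
  shows "(norm v)\<^sup>2 = (norm (P v))\<^sup>2 + (norm (v - P v))\<^sup>2"
  using orthogonal_projectionD[OF assms]
  by (simp add: power2_norm_eq_inner inner_diff_left inner_diff_right)

text \<open>Since \<open>P\<close> is self-adjoint, its kernel is the orthogonal complement of its
  range. Hence projections of equal rank also have kernels of equal dimension.\<close>

lemma dim_kernel_orthogonal_projection:
  fixes P :: "real ^ 'n \<Rightarrow> real ^ 'n"
  assumes P: "orthogonal_projection P"
  shows "dim {v. P v = 0} + dim (range P) = CARD('n)"
proof -
  note Pd = orthogonal_projectionD[OF P]
  have "(P v = 0) = (\<forall>w\<in>range P. orthogonal w v)" for v
  proof
    assume "\<forall>w\<in>range P. orthogonal w v"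
    \<comment> \<open>Test with \<open>w = P (P v)\<close>: by self-adjointness this inner product
      is the squared norm of \<open>P v\<close>.\<close>
    then have "P (P v) \<bullet> v = 0" by (auto simp: orthogonal_def)
    then show "P v = 0" using Pd(2) Pd(3)[of "P v" v] Pd(3)[of v "P v"] by simp
  qed (auto simp: orthogonal_def Pd(3))
  then have "{v. P v = 0} = {v \<in> UNIV. \<forall>w\<in>range P. orthogonal w v}" by simp
  moreover have "subspace (range P)"
    using linear_subspace_image[OF Pd(1) subspace_UNIV] .
  ultimately show ?thesis
    using dim_subspace_orthogonal_to_vectors[of "range P" UNIV] by simp
qed

lemma unitarily_equivalent_orthogonal_projections:
  fixes P Q :: "real ^ 'n \<Rightarrow> real ^ 'n"
  assumes P: "orthogonal_projection P" and Q: "orthogonal_projection Q"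
    and dim: "dim (range P) = dim (range Q)"
  obtains U where "unitary_transformation U" "U \<circ> P \<circ> adjoint U = Q"
proof -
  note Pd = orthogonal_projectionD[OF P] and Qd = orthogonal_projectionD[OF Q]
  have sub: "subspace (range P)" "subspace (range Q)" "subspace {v. P v = 0}" "subspace {v. Q v = 0}"
    using Pd(1) Qd(1) by (auto intro: linear_subspace_image linear_subspace_kernel)
  obtain f where f: "linear f" "f \<in> range P \<rightarrow> range Q" "\<And>v. v \<in> range P \<Longrightarrow> norm (f v) = norm v"
    using isometry_subset_subspace[OF sub(1,2)] dim by auto
  have "dim {v. P v = 0} = dim {v. Q v = 0}"
    using dim_kernel_orthogonal_projection[OF P] dim_kernel_orthogonal_projection[OF Q] dim by simp
  then obtain g where g: "linear g" "g \<in> {v. P v = 0} \<rightarrow> {v. Q v = 0}"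
    "\<And>v. P v = 0 \<Longrightarrow> norm (g v) = norm v"
    using isometry_subset_subspace[OF sub(3,4)] by auto
  have Pker: "P (v - P v) = 0" for v
    by (simp add: Pd(2) linear_diff[OF Pd(1)])
  \<comment> \<open>\<open>f\<close> and \<open>g\<close> are linear everywhere but known to be
    isometric only on \<open>range P\<close> and on the kernel of \<open>P\<close>, so each acts on
    the matching component of \<open>v\<close>.\<close>
  define U where "U v = f (P v) + g (v - P v)" for v
  have "linear U"
    unfolding U_def using f(1) g(1) Pd(1)
    by (intro linear_compose_add linear_compose_sub linear_compose[of P f, unfolded o_def]
        linear_compose[of "\<lambda>v. v - P v" g, unfolded o_def] linear_ident)
  \<comment> \<open>\<open>Q\<close> fixes the \<open>f\<close> part and kills the \<open>g\<close>
    part. Together with \<open>UP\<close> this yields \<open>Q (U v) = U (P v)\<close>; evaluating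
    at \<open>adjoint U v\<close> then gives the conjugation identity.\<close>
  have QU: "Q (U v) = f (P v)" for v
  proof -
    have "f (P v) \<in> range Q" using f(2) by blast
    then have "Q (f (P v)) = f (P v)" using Qd(2) by fastforce
    moreover have "Q (g (v - P v)) = 0" using g(2) Pker by blast
    ultimately show ?thesis by (simp add: U_def linear_add[OF Qd(1)])
  qed
  have UP: "U (P v) = f (P v)" for v
    by (simp add: U_def Pd(2) linear_0[OF g(1)])
  have "(norm (U v))\<^sup>2 = (norm v)\<^sup>2" for v
  proof -
    \<comment> \<open>The two pieces of \<open>U v\<close> are its components with respect to
      \<open>Q\<close>, so Pythagoras for \<open>Q\<close> and for \<open>P\<close> can be compared
      term by term.\<close>
    have "(norm (U v))\<^sup>2 = (norm (f (P v)))\<^sup>2 + (norm (g (v - P v)))\<^sup>2"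
      unfolding norm_orthogonal_projection_decomp[OF Q, of "U v"] QU by (simp add: U_def)
    then show ?thesis
      unfolding norm_orthogonal_projection_decomp[OF P, of v] using f(3) g(3) Pker by simp
  qed
  then have "unitary_transformation U"
    using \<open>linear U\<close> by (intro unitary_transformationI) simp_all
  moreover from this have "U \<circ> P \<circ> adjoint U = Q"
    by (simp add: fun_eq_iff UP QU[symmetric] unitary_transformationD(3))
  ultimately show thesis by (rule that)
qed

theorem theorem3p7:
  fixes x :: "nat \<Rightarrow> real ^ 'n" and m k :: nat and P :: "real ^ 'n \<Rightarrow> real ^ 'n"
  assumes "is_frame m x"
    and "orthogonal_projection P"
    and "dim (range P) = k"
    and "piecewise_scalable_with m x P"
  shows "(\<forall>U. unitary_transformation U \<longrightarrow> piecewise_scalable m (\<lambda>i. U (x i))) \<and>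
         (\<forall>Q. orthogonal_projection Q \<and> dim (range Q) = k \<longrightarrow>
           (\<exists>U. unitary_transformation U \<and> piecewise_scalable_with m (\<lambda>i. U (x i)) Q))"
proof (intro conjI allI impI)
  show "piecewise_scalable m (\<lambda>i. U (x i))" if "unitary_transformation U" for U
    using piecewise_scalable_with_unitary[OF that assms(4)] unfolding piecewise_scalable_def by blast
next
  fix Q :: "real ^ 'n \<Rightarrow> real ^ 'n"
  assume "orthogonal_projection Q \<and> dim (range Q) = k"
  then obtain U where "unitary_transformation U" "U \<circ> P \<circ> adjoint U = Q"
    using unitarily_equivalent_orthogonal_projections[OF assms(2)] assms(3) by metis
  then show "\<exists>U. unitary_transformation U \<and> piecewise_scalable_with m (\<lambda>i. U (x i)) Q"
    using piecewise_scalable_with_unitary[OF _ assms(4)] by blast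
qed

end
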